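(* Let $n\ge 1$ and let $\psi\in\mathcal T_n$ be not identically zero. Then (the extension of) $\psi$ maps the domain $\{z\in\mathbb C^n:\operatorname{Re}z_j<0,\ j=1,\dots,n\}$ into the half-plane $\{\zeta\in\mathbb C:\operatorname{Re}\zeta<0\}$, and, for every $\theta\in[0,\pi]$, it maps the cone $S_\theta^n$ into the sector $S_\theta$.
   Context: A function in $C^\infty((-\infty,0)^n)$ is called absolutely monotone if it is nonnegative together with all its partial derivatives of all orders. $\mathcal T_n$ is the class of all nonpositive functions in $C^\infty((-\infty,0)^n)$ all of whose first-order partial derivatives are absolutely monotone. Every $\psi\in\mathcal T_n$ has a representation $$\psi(z)=c_0+c_1\cdot z+\int_{\mathbb R_+^n\setminus\{0\}}(e^{z\cdot u}-1)\,d\mu(u)$$ for $z\in(-\infty,0)^n$, with $c_0=\lim_{s\to-0}\psi(s)\le0$, $c_1\in\mathbb R_+^n$ and $\mu$ a positive Radon measure on $\mathbb R_+^n\setminus\{0\}$ (where $\mathbb R_+=[0,\infty)$, $a\cdot b=\sum_i a_ib_i$, and $s\to-0$ means every $s_i$ tends to $0$ from the left) such that, for small $\delta>0$, the functions $u\mapsto u_j$ are $\mu$-integrable on $[0,\delta)^n\setminus\{0\}$ and $\mu(\mathbb R_+^n\setminus[0,\delta)^n)<\infty$. By this formula $\psi$ is extended to a function holomorphic in $\{z\in\mathbb C^n:\operatorname{Re}z_j<0,\ j=1,\dots,n\}$ and continuous on its closure; the extended function is still denoted $\psi$ and regarded as an element of $\mathcal T_n$. For $\theta\in[0,\pi]$,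 $S_\theta$ denotes the closure of the sector $\{\zeta\in\mathbb C:\frac{\pi}{2}+\frac{\theta}{2}<\arg\zeta<\frac{3\pi}{2}-\frac{\theta}{2}\}$, and $S_\theta^n$ is its $n$-fold Cartesian power. *)

theory Defs
  imports "HOL-Analysis.Analysis"
begin

definition neg_orthant :: "(real ^ 'n::finite) set" where
  "neg_orthant = {x. \<forall>i. x $ i < 0}"

definition left_domain :: "(complex ^ 'n::finite) set" where
  "left_domain = {z. \<forall>i. Re (z $ i) < 0}"

definition closed_left_domain :: "(complex ^ 'n::finite) set" where
  "closed_left_domain = {z. \<forall>i. Re (z $ i) \<le> 0}"

definition partial :: "'n \<Rightarrow> (real ^ 'n::finite \<Rightarrow> real) \<Rightarrow> (real ^ 'n \<Rightarrow> real)" where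
  "partial i f = (\<lambda>x. deriv (\<lambda>t. f (x + t *\<^sub>R axis i 1)) 0)"

fun partials :: "'n list \<Rightarrow> (real ^ 'n::finite \<Rightarrow> real) \<Rightarrow> (real ^ 'n \<Rightarrow> real)" where
  "partials [] f = f"
| "partials (i # is) f = partial i (partials is f)"

text \<open>For an open set \<open>U\<close>, the class of infinitely differentiable functions: all
  iterated partial derivatives exist and are continuous on \<open>U\<close>.  (As \<open>U\<close> is open, the
  values of the functions outside \<open>U\<close> do not matter.)\<close>

definition smooth_on :: "(real ^ 'n::finite) set \<Rightarrow> (real ^ 'n \<Rightarrow> real) \<Rightarrow> bool" where
  "smooth_on U f \<longleftrightarrow>
     (\<forall>is. continuous_on U (partials is f) \<and>
           (\<forall>x\<in>U. \<forall>i. (\<lambda>t. partials is f (x + t *\<^sub>R axis i 1)) differentiable (at 0)))"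

definition absolutely_monotone :: "(real ^ 'n::finite \<Rightarrow> real) \<Rightarrow> bool" where
  "absolutely_monotone f \<longleftrightarrow>
     smooth_on neg_orthant f \<and> (\<forall>is. \<forall>x\<in>neg_orthant. 0 \<le> partials is f x)"

definition class_T :: "(real ^ 'n::finite \<Rightarrow> real) set" where
  "class_T = {\<psi>. smooth_on neg_orthant \<psi> \<and> (\<forall>x\<in>neg_orthant. \<psi> x \<le> 0) \<and>
                  (\<forall>i. absolutely_monotone (partial i \<psi>))}"

definition punctured_orthant :: "(real ^ 'n::finite) set" where
  "punctured_orthant = {u. \<forall>i. 0 \<le> u $ i} - {0}"

text \<open>On the locally compact, \<open>\<sigma>\<close>-compact metric space \<^term>\<open>punctured_orthant\<close>, a positive
  Radon measure is the same as a Borel measure that is finite on compact sets; regularity is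
  automatic.\<close>

definition radon_measure :: "(real ^ 'n::finite) measure \<Rightarrow> bool" where
  "radon_measure M \<longleftrightarrow>
     sets M = sets (restrict_space borel punctured_orthant) \<and>
     (\<forall>K. compact K \<and> K \<subseteq> punctured_orthant \<longrightarrow> emeasure M K < \<infinity>)"

definition represents ::
    "real \<Rightarrow> real ^ 'n \<Rightarrow> (real ^ 'n) measure \<Rightarrow> (real ^ 'n::finite \<Rightarrow> real) \<Rightarrow> bool" where
  "represents c0 c1 M \<psi> \<longleftrightarrow>
     (\<psi> \<longlongrightarrow> c0) (at 0 within neg_orthant) \<and> c0 \<le> 0 \<and> (\<forall>i. 0 \<le> c1 $ i) \<and>
     radon_measure M \<and>
     (\<forall>\<^sub>F \<delta> in at_right 0.
        (\<forall>j. set_integrable M {u \<in> punctured_orthant. \<forall>i. u $ i < \<delta>} (\<lambda>u. u $ j)) \<and>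
        emeasure M {u \<in> punctured_orthant. \<not> (\<forall>i. u $ i < \<delta>)} < \<infinity>) \<and>
     (\<forall>x\<in>neg_orthant. \<psi> x = c0 + c1 \<bullet> x + (\<integral>u. (exp (x \<bullet> u) - 1) \<partial>M))"

text \<open>The product is bilinear (no conjugation), unlike the complex inner product.\<close>

definition cdot :: "complex ^ 'n \<Rightarrow> real ^ 'n::finite \<Rightarrow> complex" where
  "cdot z u = (\<Sum>i\<in>UNIV. z $ i * of_real (u $ i))"

text \<open>\<open>F\<close> is the extension of \<open>\<psi>\<close> to the closed domain by means of the integral formula.
  Only the values of \<open>F\<close> on \<^term>\<open>closed_left_domain\<close> are constrained.\<close>

definition is_extension :: "(real ^ 'n::finite \<Rightarrow> real) \<Rightarrow> (complex ^ 'n \<Rightarrow> complex) \<Rightarrow> bool" where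
  "is_extension \<psi> F \<longleftrightarrow>
     (\<exists>c0 c1 M. represents c0 c1 M \<psi> \<and>
        (\<forall>z\<in>closed_left_domain.
           F z = of_real c0 + cdot z c1 + (\<integral>u. (exp (cdot z u) - 1) \<partial>M)))"

text \<open>For \<open>\<theta> = \<pi>\<close> the open sector is empty; its closure is then read as the degenerate
  closed sector, i.e. the ray of nonpositive reals, which is the intersection of the
  closed sectors for \<open>\<theta> < \<pi>\<close>.\<close>

definition sector :: "real \<Rightarrow> complex set" where
  "sector \<theta> =
     (if \<theta> = pi then {\<zeta>. Im \<zeta> = 0 \<and> Re \<zeta> \<le> 0}
      else closure {\<zeta>. pi/2 + \<theta>/2 < Arg2pi \<zeta> \<and> Arg2pi \<zeta> < 3*pi/2 - \<theta>/2})"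

definition sector_power :: "real \<Rightarrow> (complex ^ 'n::finite) set" where
  "sector_power \<theta> = {z. \<forall>i. z $ i \<in> sector \<theta>}"

end

theory Submission
  imports Defs
begin

text \<open>
  The closed sector \<open>S\<^sub>\<theta>\<close> is a closed convex cone \<open>K\<close> in the left half-plane, bounded by two
  rays that are symmetric about the real axis.  The value of the extension at \<open>z\<close> is assembled
  from \<open>c0\<close>, from \<open>c1 \<cdot> z\<close> and from the numbers \<open>exp (z \<cdot> u) - 1\<close> by sums with nonnegative
  coefficients and by integration against a positive measure, and \<open>K\<close> is stable under these
  operations.  As every \<open>z \<cdot> u\<close> lies in \<open>K\<close> when all coordinates of \<open>z\<close> do, the claim about
  sectors reduces to one fact about a single complex variable: \<open>w \<in> K\<close> implies
  \<open>exp w - 1 \<in> K\<close> (lemma \<open>exp_minus_one_in_wedge\<close>), which follows from \<open>\<bar>sin b\<bar> \<le> \<bar>b\<bar>\<close>,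
  \<open>cos b \<le> 1\<close> and \<open>1 - a \<le> exp (- a)\<close>.

  For the strict inequality on the open domain, \<open>Re (F z)\<close> is a sum of three nonpositive terms.
  If it vanished, each term would vanish; since \<open>Re (exp (z \<cdot> u)) < 1\<close> for every nonzero \<open>u\<close> in
  the closed orthant, this forces \<open>c0 = 0\<close>, \<open>c1 = 0\<close> and \<open>\<mu> = 0\<close>, so that \<open>\<psi>\<close> would be
  identically zero.

  The integral in the formula is the Bochner integral, which is \<open>0\<close> for functions that
  are not integrable; integrability of \<open>exp (z \<cdot> u) - 1\<close> is therefore established first
  (lemma \<open>integrable_exp_cdot\<close>).
\<close>

section \<open>Sectors as convex cones\<close>

text \<open>Describing the sector by linear inequalities in the real part and in the modulus of the
  imaginary part makes its convexity usable under the integral sign.  The two parameters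
  \<open>s = sin (\<theta>/2)\<close> and \<open>c = cos (\<theta>/2)\<close>, rather than their quotient, include the degenerate
  case \<open>\<theta> = \<pi>\<close>.\<close>

definition wedge :: "real \<Rightarrow> real \<Rightarrow> complex set" where
  "wedge s c = {\<zeta>. Re \<zeta> \<le> 0 \<and> s * \<bar>Im \<zeta>\<bar> \<le> - c * Re \<zeta>}"

lemma closed_wedge: "closed (wedge s c)"
  unfolding wedge_def Collect_conj_eq
  by (intro closed_Int closed_Collect_le continuous_intros)

lemma wedge_add:
  assumes "0 \<le> s" "v \<in> wedge s c" "w \<in> wedge s c"
  shows "v + w \<in> wedge s c"
proof -
  have "s * \<bar>Im v + Im w\<bar> \<le> s * (\<bar>Im v\<bar> + \<bar>Im w\<bar>)"
    using assms(1) by (intro mult_left_mono) auto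
  then show ?thesis
    using assms by (auto simp: wedge_def algebra_simps)
qed

lemma wedge_scale:
  assumes "w \<in> wedge s c" "0 \<le> (t::real)"
  shows "w * of_real t \<in> wedge s c"
proof -
  have "(s * \<bar>Im w\<bar>) * t \<le> (- c * Re w) * t"
    using assms by (intro mult_right_mono) (auto simp: wedge_def)
  then show ?thesis
    using assms by (auto simp: wedge_def abs_mult mult_ac mult_nonpos_nonneg mult_nonneg_nonpos)
qed

lemma wedge_of_real: "0 \<le> c \<Longrightarrow> t \<le> 0 \<Longrightarrow> of_real t \<in> wedge s c"
  by (auto simp: wedge_def mult_nonneg_nonpos)

lemma wedge_sum:
  assumes "0 \<le> s" "finite A" "\<And>i. i \<in> A \<Longrightarrow> f i \<in> wedge s c"
  shows "(\<Sum>i\<in>A. f i) \<in> wedge s c"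
  using assms(2,3)
proof (induction A rule: finite_induct)
  case empty
  then show ?case by (simp add: wedge_def)
next
  case (insert x A)
  then show ?case by (simp add: wedge_add[OF assms(1)])
qed

lemma wedge_integral:
  assumes s: "0 \<le> s" and f: "integrable M f"
    and mem: "\<And>u. u \<in> space M \<Longrightarrow> f u \<in> wedge s c"
  shows "integral\<^sup>L M f \<in> wedge s c"
proof -
  have re: "integrable M (\<lambda>u. Re (f u))" and im: "integrable M (\<lambda>u. Im (f u))"
    using f by auto
  have "s * \<bar>\<integral>u. Im (f u) \<partial>M\<bar> \<le> s * (\<integral>u. \<bar>Im (f u)\<bar> \<partial>M)"
    using s by (intro mult_left_mono integral_abs_bound)
  also have "\<dots> = (\<integral>u. s * \<bar>Im (f u)\<bar> \<partial>M)"
    by simp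
  also have "\<dots> \<le> (\<integral>u. - c * Re (f u) \<partial>M)"
    using re im mem by (intro integral_mono) (auto simp: wedge_def)
  also have "\<dots> = - c * (\<integral>u. Re (f u) \<partial>M)"
    by simp
  finally have "s * \<bar>\<integral>u. Im (f u) \<partial>M\<bar> \<le> - c * (\<integral>u. Re (f u) \<partial>M)" .
  moreover have "(\<integral>u. Re (f u) \<partial>M) \<le> (\<integral>u. 0 \<partial>M)"
    using re mem by (intro integral_mono) (auto simp: wedge_def)
  ultimately show ?thesis
    using f by (simp add: wedge_def)
qed

text \<open>With \<open>w = a + i b\<close> the second inequality of the wedge for \<open>exp w - 1\<close> reads
  \<open>exp a * (s * \<bar>sin b\<bar> + c * cos b) \<le> c\<close>.  The bracket is at most
  \<open>s * \<bar>b\<bar> + c \<le> c * (1 - a) \<le> c * exp (- a)\<close>.\<close>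

lemma exp_minus_one_in_wedge:
  assumes "0 \<le> s" "0 \<le> c" and w: "w \<in> wedge s c"
  shows "exp w - 1 \<in> wedge s c"
proof -
  define a b where "a = Re w" and "b = Im w"
  have a: "a \<le> 0" and sb: "s * \<bar>b\<bar> \<le> - c * a"
    using w by (auto simp: wedge_def a_def b_def)
  have "s * \<bar>sin b\<bar> + c * cos b \<le> s * \<bar>b\<bar> + c * 1"
    using assms by (intro add_mono mult_left_mono abs_sin_x_le_abs_x) auto
  also have "\<dots> \<le> c * (1 + (- a))"
    using sb by (simp add: algebra_simps)
  also have "\<dots> \<le> c * exp (- a)"
    using assms by (intro mult_left_mono exp_ge_add_one_self) auto
  finally have "exp a * (s * \<bar>sin b\<bar> + c * cos b) \<le> exp a * (c * exp (- a))"
    by (intro mult_left_mono) auto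
  also have "\<dots> = c"
    by (simp add: exp_minus)
  finally have "s * \<bar>exp a * sin b\<bar> \<le> - c * (exp a * cos b - 1)"
    by (simp add: algebra_simps abs_mult)
  moreover have "exp a * cos b \<le> 1"
  proof -
    have "exp a * cos b \<le> exp a * 1"
      by (intro mult_left_mono) auto
    also have "\<dots> \<le> 1"
      using a by simp
    finally show ?thesis .
  qed
  ultimately show ?thesis
    by (simp add: wedge_def Re_exp Im_exp a_def b_def)
qed

text \<open>Measured from the negative axis, by \<open>Arg2pi \<zeta> = \<pi> + \<eta>\<close>, the angle enters the sector
  symmetrically: for \<open>\<zeta> \<noteq> 0\<close> the inequalities \<open>s * \<bar>Im \<zeta>\<bar> \<le> - c * Re \<zeta>\<close> become
  \<open>cos (\<eta> + \<theta>/2) \<ge> 0\<close> and \<open>cos (\<eta> - \<theta>/2) \<ge> 0\<close>.\<close>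

lemma polar_about_negative_axis:
  obtains \<eta> where "Arg2pi \<zeta> = pi + \<eta>" "- pi \<le> \<eta>" "\<eta> < pi"
    "Re \<zeta> = - (norm \<zeta> * cos \<eta>)" "Im \<zeta> = - (norm \<zeta> * sin \<eta>)"
proof
  let ?\<eta> = "Arg2pi \<zeta> - pi"
  have "\<zeta> = norm \<zeta> * exp (\<i> * Arg2pi \<zeta>)"
    by (rule Arg2pi_eq)
  then have "\<zeta> = rcis (norm \<zeta>) (Arg2pi \<zeta>)"
    by (simp add: rcis_def cis_conv_exp)
  then have "Re \<zeta> = norm \<zeta> * cos (Arg2pi \<zeta>)" "Im \<zeta> = norm \<zeta> * sin (Arg2pi \<zeta>)"
    by (metis Re_rcis, metis Im_rcis)
  then show "Re \<zeta> = - (norm \<zeta> * cos ?\<eta>)" "Im \<zeta> = - (norm \<zeta> * sin ?\<eta>)"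
    by (simp_all add: cos_diff sin_diff)
  show "- pi \<le> ?\<eta>" "?\<eta> < pi"
    using Arg2pi_ge_0[of \<zeta>] Arg2pi_lt_2pi[of \<zeta>] by auto
qed simp

lemma open_sector_subset_wedge:
  assumes "0 \<le> \<theta>" "pi/2 + \<theta>/2 < Arg2pi \<zeta>" "Arg2pi \<zeta> < 3*pi/2 - \<theta>/2"
  shows "\<zeta> \<in> wedge (sin (\<theta>/2)) (cos (\<theta>/2))"
proof -
  obtain \<eta> where \<eta>: "Arg2pi \<zeta> = pi + \<eta>"
      "Re \<zeta> = - (norm \<zeta> * cos \<eta>)" "Im \<zeta> = - (norm \<zeta> * sin \<eta>)"
    by (rule polar_about_negative_axis)
  have "0 \<le> cos \<eta>" "0 \<le> cos (\<eta> + \<theta>/2)" "0 \<le> cos (\<eta> - \<theta>/2)"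
    using assms \<eta>(1) by (auto intro!: cos_ge_zero)
  then have "0 \<le> cos \<eta>" "sin (\<theta>/2) * \<bar>sin \<eta>\<bar> \<le> cos (\<theta>/2) * cos \<eta>"
    by (auto simp: abs_if cos_add cos_diff mult.commute)
  then have "0 \<le> norm \<zeta> * cos \<eta>"
      "norm \<zeta> * (sin (\<theta>/2) * \<bar>sin \<eta>\<bar>) \<le> norm \<zeta> * (cos (\<theta>/2) * cos \<eta>)"
    by (auto intro!: mult_left_mono)
  then show ?thesis
    using \<eta>(2,3) by (simp add: wedge_def abs_mult mult_ac)
qed

lemma cos_pos_imp_lt_half_pi:
  assumes "0 < cos x" "0 \<le> x" "x < 3*pi/2"
  shows "x < pi/2"
proof (rule ccontr)
  assume "\<not> x < pi/2"
  then have "0 \<le> cos (x - pi)"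
    using assms by (intro cos_ge_zero) auto
  then show False
    using assms(1) by (simp add: cos_diff)
qed

lemma wedge_interior_subset_open_sector:
  assumes "0 \<le> \<theta>" "\<theta> < pi" and "Re \<zeta> < 0"
    and "sin (\<theta>/2) * \<bar>Im \<zeta>\<bar> < - cos (\<theta>/2) * Re \<zeta>"
  shows "pi/2 + \<theta>/2 < Arg2pi \<zeta> \<and> Arg2pi \<zeta> < 3*pi/2 - \<theta>/2"
proof -
  obtain \<eta> where \<eta>: "Arg2pi \<zeta> = pi + \<eta>" "- pi \<le> \<eta>" "\<eta> < pi"
      "Re \<zeta> = - (norm \<zeta> * cos \<eta>)" "Im \<zeta> = - (norm \<zeta> * sin \<eta>)"
    by (rule polar_about_negative_axis)
  have "norm \<zeta> * (sin (\<theta>/2) * \<bar>sin \<eta>\<bar>) < norm \<zeta> * (cos (\<theta>/2) * cos \<eta>)"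
    using assms(4) unfolding \<eta>(4,5) by (simp add: abs_mult mult_ac)
  then have "sin (\<theta>/2) * \<bar>sin \<eta>\<bar> < cos (\<theta>/2) * cos \<eta>"
    by (simp add: mult_less_cancel_left)
  moreover have "sin (\<theta>/2) * sin \<bar>\<eta>\<bar> \<le> sin (\<theta>/2) * \<bar>sin \<eta>\<bar>"
    using assms by (intro mult_left_mono sin_ge_zero) (auto simp: abs_if)
  moreover have "cos \<bar>\<eta>\<bar> = cos \<eta>"
    by (simp add: abs_if)
  ultimately have "0 < cos (\<bar>\<eta>\<bar> + \<theta>/2)"
    by (simp add: cos_add mult.commute)
  then have "\<bar>\<eta>\<bar> + \<theta>/2 < pi/2"
    using assms \<eta>(2,3) by (intro cos_pos_imp_lt_half_pi) auto
  then show ?thesis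
    using \<eta>(1) by auto
qed

lemma sector_eq_wedge:
  assumes "\<theta> \<in> {0..pi}"
  shows "sector \<theta> = wedge (sin (\<theta>/2)) (cos (\<theta>/2))"
proof (cases "\<theta> = pi")
  case True
  then show ?thesis
    by (auto simp: sector_def wedge_def)
next
  case False
  define S where "S = {\<zeta>. pi/2 + \<theta>/2 < Arg2pi \<zeta> \<and> Arg2pi \<zeta> < 3*pi/2 - \<theta>/2}"
  have \<theta>: "0 \<le> \<theta>" "\<theta> < pi"
    using assms False by auto
  then have c: "0 < cos (\<theta>/2)"
    by (intro cos_gt_zero_pi) auto
  have "closure S \<subseteq> wedge (sin (\<theta>/2)) (cos (\<theta>/2))"
    using open_sector_subset_wedge \<theta>(1)
    by (intro closure_minimal closed_wedge) (auto simp: S_def)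
  moreover have "wedge (sin (\<theta>/2)) (cos (\<theta>/2)) \<subseteq> closure S"
  proof
    fix \<zeta> assume \<zeta>: "\<zeta> \<in> wedge (sin (\<theta>/2)) (cos (\<theta>/2))"
    (* Translating by a negative real number moves the wedge into its interior. *)
    have "\<zeta> - of_real e \<in> S" if "0 < e" for e :: real
    proof -
      have "0 < cos (\<theta>/2) * e"
        using c that by simp
      then have "sin (\<theta>/2) * \<bar>Im (\<zeta> - of_real e)\<bar> < - cos (\<theta>/2) * Re (\<zeta> - of_real e)"
        using \<zeta> by (simp add: wedge_def algebra_simps)
      moreover have "Re (\<zeta> - of_real e) < 0"
        using \<zeta> that by (simp add: wedge_def)
      ultimately show ?thesis
        unfolding S_def using wedge_interior_subset_open_sector[OF \<theta>] by blast
    qed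
    then have "\<exists>y\<in>S. dist y \<zeta> < e" if "0 < e" for e
      using that by (intro bexI[of _ "\<zeta> - of_real (e/2)"]) (auto simp: dist_norm simp del: of_real_divide)
    then show "\<zeta> \<in> closure S"
      by (simp add: closure_approachable)
  qed
  ultimately show ?thesis
    using False by (simp add: sector_def S_def)
qed

section \<open>Integrability of the kernel\<close>

text \<open>The derivative of \<open>exp\<close> is bounded by \<open>1\<close> on the left half-plane, which is convex.\<close>

lemma norm_exp_minus_one_le:
  assumes "Re w \<le> 0"
  shows "norm (exp w - 1) \<le> norm w"
proof -
  have "norm (exp w - exp 0) \<le> 1 * norm (w - 0)"
    by (rule field_differentiable_bound[where S = "{z. Re z \<le> 0}" and f' = exp])
       (use assms in \<open>auto intro!: derivative_eq_intros convex_halfspace_Re_le\<close>)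
  then show ?thesis
    by simp
qed

lemma norm_exp_minus_one_le_2:
  assumes "Re w \<le> 0"
  shows "norm (exp w - 1) \<le> 2"
proof -
  have "norm (exp w - 1) \<le> norm (exp w) + norm (1::complex)"
    by (rule norm_triangle_ineq4)
  also have "\<dots> \<le> 1 + 1"
    using assms by (intro add_mono) auto
  finally show ?thesis by simp
qed

lemma space_radon_measure:
  assumes "radon_measure M"
  shows "space M = punctured_orthant"
proof -
  have "space M = space (restrict_space borel punctured_orthant)"
    using assms by (intro sets_eq_imp_space_eq) (simp add: radon_measure_def)
  then show ?thesis
    by (simp add: space_restrict_space)
qed

lemma borel_measurable_radon_measure:
  assumes "radon_measure M" "f \<in> borel_measurable borel"
  shows "f \<in> borel_measurable M"
proof -
  have "f \<in> borel_measurable (restrict_space borel punctured_orthant)"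
    using assms(2) by (rule measurable_restrict_space1)
  then show ?thesis
    using assms(1) measurable_cong_sets[of M "restrict_space borel punctured_orthant" borel borel]
    by (auto simp: radon_measure_def)
qed

lemma cdot_in_wedge:
  assumes "0 \<le> s" "\<And>i. z $ i \<in> wedge s c" "\<And>i. 0 \<le> u $ i"
  shows "cdot z u \<in> wedge s c"
  unfolding cdot_def using assms by (intro wedge_sum wedge_scale) auto

lemma Re_cdot: "Re (cdot z u) = (\<Sum>i\<in>UNIV. Re (z $ i) * u $ i)"
  by (simp add: cdot_def)

lemma Re_cdot_nonpos:
  assumes "z \<in> closed_left_domain" "\<And>i. 0 \<le> u $ i"
  shows "Re (cdot z u) \<le> 0"
  unfolding Re_cdot
  using assms by (intro sum_nonpos mult_nonpos_nonneg) (auto simp: closed_left_domain_def)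

text \<open>Near the origin the integrand is dominated by a multiple of \<open>\<Sum>j. u $ j\<close>, and
  away from the origin by the constant \<open>2\<close>; the representation makes the first function
  integrable and the second region of finite measure.\<close>

lemma integrable_exp_cdot:
  fixes z :: "complex ^ 'n::finite"
  assumes rep: "represents c0 c1 M \<psi>" and z: "z \<in> closed_left_domain"
  shows "integrable M (\<lambda>u. exp (cdot z u) - 1)"
proof -
  have rad: "radon_measure M"
    using rep by (simp add: represents_def)
  note sp = space_radon_measure[OF rad]
  define A B where "A = (\<lambda>\<delta>. {u \<in> punctured_orthant :: (real ^ 'n) set. \<forall>i. u $ i < \<delta>})"
    and "B = (\<lambda>\<delta>. {u \<in> punctured_orthant :: (real ^ 'n) set. \<not> (\<forall>i. u $ i < \<delta>)})"
  have "\<forall>\<^sub>F \<delta> in at_right 0.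
      (\<forall>j. set_integrable M (A \<delta>) (\<lambda>u. u $ j)) \<and> emeasure M (B \<delta>) < \<infinity>"
    using rep by (simp add: represents_def A_def B_def)
  then obtain \<delta> where int: "\<And>j. set_integrable M (A \<delta>) (\<lambda>u. u $ j)"
      and fin: "emeasure M (B \<delta>) < \<infinity>"
    using eventually_happens' trivial_limit_at_right_real by blast
  define C where "C = (\<Sum>i\<in>UNIV. norm (z $ i))"
  have cont: "continuous_on UNIV (cdot z)"
    unfolding cdot_def by (intro continuous_intros)
  have meas: "(\<lambda>u. exp (cdot z u) - 1) \<in> borel_measurable M"
    by (intro borel_measurable_radon_measure[OF rad] borel_measurable_continuous_onI
        continuous_intros cont)
  have "B \<delta> = {u \<in> space M. \<not> (\<forall>i. u $ i < \<delta>)}"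
    by (simp add: B_def sp)
  also have "\<dots> \<in> sets M"
  proof -
    have [measurable]: "(\<lambda>u. u $ i) \<in> borel_measurable M" for i
      by (intro borel_measurable_radon_measure[OF rad] borel_measurable_continuous_onI
          continuous_intros)
    show ?thesis
      by measurable
  qed
  finally have B: "B \<delta> \<in> sets M" .
  define g where "g = (\<lambda>u. C * (\<Sum>j\<in>UNIV. indicator (A \<delta>) u *\<^sub>R u $ j) + 2 * indicator (B \<delta>) u :: real)"
  have "integrable M g"
    unfolding g_def
    by (intro Bochner_Integration.integrable_add integrable_mult_right Bochner_Integration.integrable_sum
        integrable_real_indicator B fin int[unfolded set_integrable_def])
  then show ?thesis
  proof (rule Bochner_Integration.integrable_bound[OF _ meas], intro AE_I2)
    fix u assume u: "u \<in> space M"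
    then have pos: "0 \<le> u $ i" for i
      by (simp add: sp punctured_orthant_def)
    have re: "Re (cdot z u) \<le> 0"
      using z pos by (rule Re_cdot_nonpos)
    show "norm (exp (cdot z u) - 1) \<le> norm (g u)"
    proof (cases "u \<in> A \<delta>")
      case True
      have "norm (exp (cdot z u) - 1) \<le> norm (cdot z u)"
        using re by (rule norm_exp_minus_one_le)
      also have "\<dots> \<le> (\<Sum>i\<in>UNIV. norm (z $ i) * u $ i)"
        unfolding cdot_def using pos by (intro sum_norm_le) (simp add: norm_mult)
      also have "\<dots> \<le> (\<Sum>i\<in>UNIV. C * u $ i)"
        unfolding C_def using pos
        by (intro sum_mono mult_right_mono member_le_sum) auto
      also have "\<dots> = g u"
        using True by (simp add: g_def A_def B_def sum_distrib_left)
      finally show ?thesis by simp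
    next
      case False
      then have "g u = 2"
        using u by (auto simp: g_def A_def B_def sp)
      then show ?thesis
        using norm_exp_minus_one_le_2[OF re] by simp
    qed
  qed
qed

section \<open>The mapping theorem\<close>

lemma Re_cdot_neg:
  assumes z: "z \<in> left_domain" and u: "\<And>i. 0 \<le> u $ i" "u \<noteq> 0"
  shows "Re (cdot z u) < 0"
proof -
  obtain j where "u $ j \<noteq> 0"
    using u(2) by (auto simp: vec_eq_iff)
  then have "0 < u $ j"
    using u(1)[of j] by simp
  then have "Re (z $ j) * u $ j < 0"
    using z by (simp add: left_domain_def mult_neg_pos)
  moreover have "Re (z $ i) * u $ i \<le> 0" for i
    using z u(1)[of i] by (intro mult_nonpos_nonneg) (auto simp: left_domain_def intro: less_imp_le)
  ultimately have "(\<Sum>i\<in>UNIV. Re (z $ i) * u $ i) < (\<Sum>i\<in>(UNIV::'a set). 0)"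
    by (intro sum_strict_mono_ex1) auto
  then show ?thesis
    by (simp add: Re_cdot)
qed

lemma extension_maps_wedge:
  assumes rep: "represents c0 c1 M \<psi>" and s: "0 \<le> s" and c: "0 \<le> c"
    and z: "\<And>i. z $ i \<in> wedge s c"
  shows "of_real c0 + cdot z c1 + (\<integral>u. (exp (cdot z u) - 1) \<partial>M) \<in> wedge s c"
proof -
  have rad: "radon_measure M" and c0: "c0 \<le> 0" and c1: "\<And>i. 0 \<le> c1 $ i"
    using rep by (auto simp: represents_def)
  have "z \<in> closed_left_domain"
    using z by (auto simp: closed_left_domain_def wedge_def)
  then have int: "integrable M (\<lambda>u. exp (cdot z u) - 1)"
    by (rule integrable_exp_cdot[OF rep])
  have "(\<integral>u. (exp (cdot z u) - 1) \<partial>M) \<in> wedge s c"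
    using s c z
    by (intro wedge_integral int exp_minus_one_in_wedge cdot_in_wedge)
       (auto simp: space_radon_measure[OF rad] punctured_orthant_def)
  then show ?thesis
    using s c c0 c1 z by (intro wedge_add wedge_of_real cdot_in_wedge)
qed

lemma extension_maps_left_domain:
  fixes z :: "complex ^ 'n::finite"
  assumes rep: "represents c0 c1 M \<psi>" and z: "z \<in> left_domain"
    and nz: "\<exists>x\<in>neg_orthant. \<psi> x \<noteq> 0"
  shows "Re (of_real c0 + cdot z c1 + (\<integral>u. (exp (cdot z u) - 1) \<partial>M)) < 0"
proof (rule ccontr)
  assume not_neg: "\<not> ?thesis"
  have rad: "radon_measure M" and c0: "c0 \<le> 0" and c1: "\<And>i. 0 \<le> c1 $ i"
    and \<psi>: "\<And>x. x \<in> neg_orthant \<Longrightarrow> \<psi> x = c0 + c1 \<bullet> x + (\<integral>u. (exp (x \<bullet> u) - 1) \<partial>M)"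
    using rep by (auto simp: represents_def)
  have zc: "z \<in> closed_left_domain"
    using z by (auto simp: left_domain_def closed_left_domain_def less_imp_le)
  note int = integrable_exp_cdot[OF rep zc]
  have kernel: "Re (exp (cdot z u)) < 1" if "u \<in> space M" for u
  proof -
    have "Re (cdot z u) < 0"
      using that z by (intro Re_cdot_neg) (auto simp: space_radon_measure[OF rad] punctured_orthant_def)
    then have "norm (exp (cdot z u)) < 1"
      by simp
    then show ?thesis
      using complex_Re_le_cmod order_le_less_trans by blast
  qed
  have integral_Re: "Re (\<integral>u. (exp (cdot z u) - 1) \<partial>M) = - (\<integral>u. 1 - Re (exp (cdot z u)) \<partial>M)"
    using int by (subst integral_Re[symmetric]) (auto simp flip: Bochner_Integration.integral_minus)
  have int': "integrable M (\<lambda>u. 1 - Re (exp (cdot z u)))"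
    using integrable_minus[OF integrable_Re[OF int]] by simp
  have pos: "AE u in M. 0 \<le> 1 - Re (exp (cdot z u))"
    using kernel by (intro AE_I2) (simp add: less_imp_le)
  have "Re (cdot z c1) \<le> 0"
    using zc c1 by (rule Re_cdot_nonpos)
  moreover have "0 \<le> (\<integral>u. 1 - Re (exp (cdot z u)) \<partial>M)"
    using pos by (rule integral_nonneg_AE)
  ultimately have zero: "c0 = 0" "Re (cdot z c1) = 0" "(\<integral>u. 1 - Re (exp (cdot z u)) \<partial>M) = 0"
    using not_neg c0 integral_Re by auto
  have "c1 = 0"
    using Re_cdot_neg[OF z c1] zero(2) by force
  have "AE u in M. 1 - Re (exp (cdot z u)) = 0"
    using integral_nonneg_eq_0_iff_AE[OF int' pos] zero(3) by simp
  then have null: "AE u in M. False"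
    by (rule AE_mp) (use kernel in \<open>force intro!: AE_I2\<close>)
  have "\<psi> x = 0" if "x \<in> neg_orthant" for x
  proof -
    have "(\<integral>u. (exp (x \<bullet> u) - 1) \<partial>M) = 0"
      using null by (intro integral_eq_zero_AE) auto
    then show ?thesis
      using \<psi>[OF that] \<open>c0 = 0\<close> \<open>c1 = 0\<close> by simp
  qed
  then show False
    using nz by blast
qed

theorem mainTheorem2:
  fixes \<psi> :: "real ^ 'n::finite \<Rightarrow> real"
    and F :: "complex ^ 'n \<Rightarrow> complex"
  assumes "\<psi> \<in> class_T"
    and "\<exists>x\<in>neg_orthant. \<psi> x \<noteq> 0"
    and "is_extension \<psi> F"
  shows "F ` left_domain \<subseteq> {\<zeta>. Re \<zeta> < 0} \<and>
         (\<forall>\<theta>\<in>{0..pi}. F ` sector_power \<theta> \<subseteq> sector \<theta>)"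
proof -
  obtain c0 c1 M where rep: "represents c0 c1 M \<psi>"
    and F: "\<And>z. z \<in> closed_left_domain \<Longrightarrow>
        F z = of_real c0 + cdot z c1 + (\<integral>u. (exp (cdot z u) - 1) \<partial>M)"
    using assms(3) by (auto simp: is_extension_def)
  have "Re (F z) < 0" if "z \<in> left_domain" for z
  proof -
    have "z \<in> closed_left_domain"
      using that by (auto simp: left_domain_def closed_left_domain_def less_imp_le)
    then show ?thesis
      using F extension_maps_left_domain[OF rep that assms(2)] by simp
  qed
  moreover have "F z \<in> sector \<theta>" if \<theta>: "\<theta> \<in> {0..pi}" and z: "z \<in> sector_power \<theta>" for \<theta> z
  proof -
    have mem: "z $ i \<in> wedge (sin (\<theta>/2)) (cos (\<theta>/2))" for i
      using z sector_eq_wedge[OF \<theta>] by (auto simp: sector_power_def)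
    then have "z \<in> closed_left_domain"
      by (auto simp: closed_left_domain_def wedge_def)
    moreover have "0 \<le> sin (\<theta>/2)" "0 \<le> cos (\<theta>/2)"
      using \<theta> by (auto intro!: sin_ge_zero cos_ge_zero)
    ultimately show ?thesis
      using F extension_maps_wedge[OF rep _ _ mem] sector_eq_wedge[OF \<theta>] by simp
  qed
  ultimately show ?thesis
    by blast
qed

end
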